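(* Let $G$ be a group containing an abelian subgroup $A$ of index $k$, and let $C$ be a semiminimal family of $G$. Then $$\chi(\operatorname{Cay}(G,C))\leq 4\,\chi(\operatorname{Sch}(G/A,C\setminus A))\leq 4k.$$
   Context: A semiminimal family of a group $G$ is a family $C=(c_\alpha)_{\alpha<\iota}$ of elements of $G$ indexed by an ordinal $\iota$ (not necessarily generating $G$) such that $c_\alpha\notin\langle c_\beta:\beta<\alpha\rangle$ for every $\alpha<\iota$. $C\setminus A$ denotes the set of members of $C$ not lying in $A$. For a group $G$ and a family $C$ of elements of $G$, the undirected Cayley graph $\operatorname{Cay}(G,C)$ has vertex set $G$, with two distinct elements $a,b$ adjacent whenever $a^{-1}b\in C\cup C^{-1}$. For $A\le G$ and $S\subseteq G$ with $S\cap A=\varnothing$, the Schreier (coset) graph $\operatorname{Sch}(G/A,S)$ has as vertices the left cosets of $A$ in $G$, two distinct cosets $gA$ and $hA$ being adjacent if there exist $s\in S\cup S^{-1}$ and $t\in hA$ such that $ts\in gA$ (equivalently, some edge of $\operatorname{Cay}(G,S)$ joins a vertex of $gA$ to a vertex of $hA$). $\chi(X)$ denotes the chromatic number, the minimum number (cardinal) of colors in a proper vertex coloring of $X$; products are products of cardinals. *)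

theory Defs
  imports "HOL-Algebra.Generated_Groups" "HOL-Algebra.Left_Coset"
begin

unbundle cardinal_syntax

text \<open>
  Following HOL's theory of cardinals, cardinals are canonical well-orders: \<open>|X|\<close> is the cardinal
  of \<open>X\<close>, \<open>\<le>o\<close> and \<open>=o\<close> compare cardinals (possibly over different types), and \<open>*c\<close> is the product.
\<close>

text \<open>
  The ordinal index of a family is given by a well-order \<open>r\<close> with index set \<open>Field r\<close>;
  \<open>underS r \<alpha>\<close> is the set of indices strictly below \<open>\<alpha>\<close>. Values of \<open>c\<close> outside \<open>Field r\<close> are irrelevant.
\<close>

definition semiminimal_family :: "('a, 'b) monoid_scheme \<Rightarrow> 'i rel \<Rightarrow> ('i \<Rightarrow> 'a) \<Rightarrow> bool" where
  "semiminimal_family G r c \<longleftrightarrow>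
     Well_order r \<and>
     (\<forall>\<alpha> \<in> Field r. c \<alpha> \<in> carrier G) \<and>
     (\<forall>\<alpha> \<in> Field r. c \<alpha> \<notin> generate G (c ` underS r \<alpha>))"

text \<open>
  A graph is a pair of a vertex set and an adjacency relation. The graphs below are simple: the
  relation is irreflexive, symmetric and contained in the square of the vertex set.
\<close>

type_synonym 'v graph = "'v set \<times> 'v rel"

definition cayley_graph :: "('a, 'b) monoid_scheme \<Rightarrow> 'a set \<Rightarrow> 'a graph" where
  "cayley_graph G S =
     (carrier G,
      {(a, b). a \<in> carrier G \<and> b \<in> carrier G \<and> a \<noteq> b \<and>
               inv\<^bsub>G\<^esub> a \<otimes>\<^bsub>G\<^esub> b \<in> S \<union> set_inv\<^bsub>G\<^esub> S})"

definition schreier_graph :: "('a, 'b) monoid_scheme \<Rightarrow> 'a set \<Rightarrow> 'a set \<Rightarrow> 'a set graph" where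
  "schreier_graph G A S =
     (lcosets\<^bsub>G\<^esub> A,
      {(P, Q). P \<in> lcosets\<^bsub>G\<^esub> A \<and> Q \<in> lcosets\<^bsub>G\<^esub> A \<and> P \<noteq> Q \<and>
               (\<exists>s \<in> S \<union> set_inv\<^bsub>G\<^esub> S. \<exists>t \<in> Q. t \<otimes>\<^bsub>G\<^esub> s \<in> P)})"

definition proper_coloring :: "'v graph \<Rightarrow> ('v \<Rightarrow> 'c) \<Rightarrow> bool" where
  "proper_coloring \<Gamma> f \<longleftrightarrow> (\<forall>(u, v) \<in> snd \<Gamma>. f u \<noteq> f v)"

text \<open>
  The chromatic number is the least cardinal \<open>|f ` V|\<close> over proper colorings \<open>f\<close>. Colors are taken
  from the type of vertices so that these cardinals form a set; as \<open>chromatic_number_le\<close> shows,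
  colors from any other type give nothing smaller.
\<close>

definition chromatic_number :: "'v graph \<Rightarrow> 'v rel" where
  "chromatic_number \<Gamma> =
     (let N = {|f ` fst \<Gamma>| | f :: 'v \<Rightarrow> 'v. proper_coloring \<Gamma> f}
      in SOME \<kappa>. \<kappa> \<in> N \<and> (\<forall>\<mu> \<in> N. \<kappa> \<le>o \<mu>))"

lemma chromatic_number_least:
  fixes \<Gamma> :: "'v graph"
  assumes "irrefl (snd \<Gamma>)"
  defines "N \<equiv> {|f ` fst \<Gamma>| | f :: 'v \<Rightarrow> 'v. proper_coloring \<Gamma> f}"
  shows "chromatic_number \<Gamma> \<in> N \<and> (\<forall>\<mu> \<in> N. chromatic_number \<Gamma> \<le>o \<mu>)"
proof -
  have "proper_coloring \<Gamma> (id :: 'v \<Rightarrow> 'v)"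
    using assms(1) by (auto simp: proper_coloring_def irrefl_def)
  then have "N \<noteq> {}" unfolding N_def by blast
  moreover have "\<forall>r \<in> N. Card_order r"
    unfolding N_def using card_of_Card_order by blast
  ultimately have "\<exists>\<kappa>. \<kappa> \<in> N \<and> (\<forall>\<mu> \<in> N. \<kappa> \<le>o \<mu>)"
    using exists_minim_Card_order by blast
  then show ?thesis
    unfolding chromatic_number_def Let_def N_def by (rule someI_ex)
qed

lemma chromatic_number_attained:
  fixes \<Gamma> :: "'v graph"
  assumes "irrefl (snd \<Gamma>)"
  obtains f :: "'v \<Rightarrow> 'v" where "proper_coloring \<Gamma> f" "chromatic_number \<Gamma> = |f ` fst \<Gamma>|"
  using chromatic_number_least[OF assms] by blast

lemma chromatic_number_le:
  fixes \<Gamma> :: "'v graph" and f :: "'v \<Rightarrow> 'c"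
  assumes "irrefl (snd \<Gamma>)" "snd \<Gamma> \<subseteq> fst \<Gamma> \<times> fst \<Gamma>" "proper_coloring \<Gamma> f"
  shows "chromatic_number \<Gamma> \<le>o |f ` fst \<Gamma>|"
proof -
  define g where "g = inv_into (fst \<Gamma>) f \<circ> f"
  have "proper_coloring \<Gamma> g"
    using assms(2,3) unfolding proper_coloring_def g_def
    by (fastforce dest: inv_into_injective)
  then have "chromatic_number \<Gamma> \<le>o |g ` fst \<Gamma>|"
    using chromatic_number_least[OF assms(1)] by blast
  also have "|g ` fst \<Gamma>| \<le>o |f ` fst \<Gamma>|"
    unfolding g_def image_comp[symmetric] by (rule card_of_image)
  finally show ?thesis .
qed

lemma irrefl_cayley_graph: "irrefl (snd (cayley_graph G S))"
  by (auto simp: irrefl_def cayley_graph_def)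

lemma irrefl_schreier_graph: "irrefl (snd (schreier_graph G A S))"
  by (auto simp: irrefl_def schreier_graph_def)

end

theory Submission
  imports Defs Complex_Main
begin

text \<open>
  The heart of the matter is the case \<open>A = G\<close>: a semiminimal Cayley graph of an abelian group has
  a proper coloring with four colors. Suppose there is a homomorphism \<open>\<phi>\<close> to the circle
  \<open>\<real>/\<int>\<close>, defined on a subgroup containing the family, that sends every member to a point at
  distance at least \<open>1/4\<close> from \<open>0\<close>. Cut the circle into four half-open quarters. Adjacent elements
  of the subgroup have images differing by some \<open>\<phi> (c \<alpha>)\<close>, so their images lie in different
  quarters, and coloring an element by the quarter of its image is proper.

  Such a \<open>\<phi>\<close> is built one member of the family at a time. If \<open>\<phi>\<close> is defined on the subgroup \<open>D\<close>
  generated by the previous members, semiminimality says \<open>c \<alpha> \<notin> D\<close>. If no positive power of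
  \<open>c \<alpha>\<close> is in \<open>D\<close>, any value of \<open>\<phi> (c \<alpha>)\<close> is allowed, for instance \<open>1/2\<close>. Otherwise let
  \<open>m \<ge> 2\<close> be the least positive exponent with \<open>c \<alpha> [^] m \<in> D\<close>. The allowed values are the
  \<open>m\<close> solutions \<open>t\<close> of \<open>m * t = \<phi> (c \<alpha> [^] m)\<close>. They are equally spaced with
  gaps \<open>1/m \<le> 1/2\<close>, so one of them falls in the closed arc \<open>[1/4, 3/4]\<close>, which has length \<open>1/2\<close>
  (\<open>partial_character_extension_value\<close>). Commutativity is what makes the extended map a
  homomorphism (\<open>partial_character_extend\<close>), and Zorn's lemma replaces the transfinite recursion
  (\<open>semiminimal_partial_character\<close>).

  For the general case, an edge of the Cayley graph labelled by an element of \<open>A\<close> stays inside a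
  left coset of \<open>A\<close>. Since left translations are automorphisms of Cayley graphs, a four-coloring of
  \<open>A\<close> can be copied to every coset, and it separates the ends of all these edges
  (\<open>cayley_coloring_from_subgroup\<close>). Any other edge joins two different cosets that are adjacent in
  the Schreier graph, so a proper coloring of that graph separates its ends. The pair of both colors
  is a proper coloring of the Cayley graph. The second inequality holds because giving all cosets
  different colors is proper.
\<close>

section \<open>Colorings of Cayley graphs\<close>

text \<open>
  Properness need only be checked along generators: an edge labelled by an inverse of a generator is
  the reverse of an edge labelled by that generator.
\<close>

lemma (in group) proper_coloring_cayley_iff:
  assumes "S \<subseteq> carrier G"
  shows "proper_coloring (cayley_graph G S) f \<longleftrightarrow>
           (\<forall>a \<in> carrier G. \<forall>s \<in> S. s \<noteq> \<one> \<longrightarrow> f a \<noteq> f (a \<otimes> s))"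
    (is "?L \<longleftrightarrow> ?R")
proof
  assume L: ?L
  show ?R
  proof (intro ballI impI)
    fix a s assume as: "a \<in> carrier G" "s \<in> S" "s \<noteq> \<one>"
    then have s: "s \<in> carrier G" using assms by blast
    have "inv a \<otimes> (a \<otimes> s) = s" using as s by (simp add: m_assoc[symmetric])
    moreover have "a \<noteq> a \<otimes> s" using as s by simp
    ultimately have "(a, a \<otimes> s) \<in> snd (cayley_graph G S)"
      using as s by (simp add: cayley_graph_def)
    with L show "f a \<noteq> f (a \<otimes> s)" by (auto simp: proper_coloring_def)
  qed
next
  assume R: ?R
  have *: "f a \<noteq> f b"
    if "a \<in> carrier G" "b \<in> carrier G" "a \<noteq> b" "inv a \<otimes> b \<in> S" for a b
  proof -
    have "a \<otimes> (inv a \<otimes> b) = b" using that by (simp add: m_assoc[symmetric])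
    moreover from this have "inv a \<otimes> b \<noteq> \<one>" using that by auto
    ultimately show ?thesis using R[rule_format, of a "inv a \<otimes> b"] that by simp
  qed
  have "f a \<noteq> f b"
    if ab: "a \<in> carrier G" "b \<in> carrier G" "a \<noteq> b" "inv a \<otimes> b \<in> S \<union> set_inv S" for a b
  proof (cases "inv a \<otimes> b \<in> S")
    case False
    then obtain s where "s \<in> S" "inv a \<otimes> b = inv s" using ab by (auto simp: SET_INV_def)
    then have "inv (inv a \<otimes> b) \<in> S" using assms by auto
    then have "inv b \<otimes> a \<in> S" using ab by (simp add: inv_mult_group)
    then show ?thesis using *[of b a] ab by auto
  qed (use * ab in blast)
  then show ?L by (auto simp: proper_coloring_def cayley_graph_def)
qed

text \<open>
  Two points of \<open>G\<close> in the same left coset of \<open>H\<close> are moved to \<open>H\<close> by the same left translation,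
  the inverse of a chosen representative. A translation preserves the labels of edges, so coloring
  each point by the color of its translate keeps the coloring proper.
\<close>
lemma (in group) cayley_coloring_from_subgroup:
  assumes H: "subgroup H G" and S: "S \<subseteq> H"
    and f: "proper_coloring (cayley_graph (G\<lparr>carrier := H\<rparr>) S) f"
  obtains g where "proper_coloring (cayley_graph G S) g" "g ` carrier G \<subseteq> f ` H"
proof -
  interpret H: subgroup H G by fact
  interpret GH: group "G\<lparr>carrier := H\<rparr>" by (rule subgroup_imp_group[OF H])
  define p where "p x = (SOME y. y \<in> x <# H)" for x
  define g where "g x = f (inv (p x) \<otimes> x)" for x
  have p: "p x \<in> carrier G \<and> inv (p x) \<otimes> x \<in> H" if x: "x \<in> carrier G" for x
  proof -
    have "x \<in> x <# H" using lcos_self[OF x H] .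
    then have "p x \<in> x <# H" unfolding p_def by (rule someI)
    then obtain h where h: "h \<in> H" "p x = x \<otimes> h" by (auto simp: l_coset_def)
    then have "inv (p x) \<otimes> x = inv h" using x by (simp add: inv_mult_group m_assoc)
    then show ?thesis using h x by simp
  qed
  have "proper_coloring (cayley_graph G S) g"
  proof (subst proper_coloring_cayley_iff, use S H.subset in blast, intro ballI impI)
    fix a s assume a: "a \<in> carrier G" and s: "s \<in> S" "s \<noteq> \<one>"
    have sH: "s \<in> H" using s S by blast
    have "a \<otimes> s \<in> a <# H" using sH by (auto simp: l_coset_def)
    then have "a <# H = (a \<otimes> s) <# H" by (metis l_repr_independence a H)
    then have pe: "p (a \<otimes> s) = p a" by (simp add: p_def)
    have "f (inv (p a) \<otimes> a) \<noteq> f ((inv (p a) \<otimes> a) \<otimes> s)"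
      using f S s p[OF a] by (simp add: GH.proper_coloring_cayley_iff)
    then show "g a \<noteq> g (a \<otimes> s)"
      using p[OF a] a sH by (simp add: g_def pe m_assoc)
  qed
  moreover have "g ` carrier G \<subseteq> f ` H" using p by (auto simp: g_def)
  ultimately show thesis by (rule that)
qed

text \<open>
  An edge labelled by an element of \<open>A\<close> is handled by \<open>f\<close>; any other edge projects to an edge of
  the Schreier graph and is handled by \<open>p\<close>.
\<close>
lemma (in group) proper_coloring_cayley_schreier:
  assumes A: "subgroup A G" and S: "S \<subseteq> carrier G"
    and f: "proper_coloring (cayley_graph G (S \<inter> A)) f"
    and p: "proper_coloring (schreier_graph G A (S - A)) p"
  shows "proper_coloring (cayley_graph G S) (\<lambda>x. (f x, p (x <# A)))"
proof (subst proper_coloring_cayley_iff[OF S], intro ballI impI)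
  fix a s assume a: "a \<in> carrier G" and s: "s \<in> S" "s \<noteq> \<one>"
  interpret A: subgroup A G by fact
  have sc: "s \<in> carrier G" using s S by blast
  show "(f a, p (a <# A)) \<noteq> (f (a \<otimes> s), p (a \<otimes> s <# A))"
  proof (cases "s \<in> A")
    case True
    have "S \<inter> A \<subseteq> carrier G" using S by blast
    then have "f a \<noteq> f (a \<otimes> s)" using f s a True by (simp add: proper_coloring_cayley_iff)
    then show ?thesis by simp
  next
    case False
    have in_coset: "a \<otimes> s \<in> (a \<otimes> s) <# A" "a \<in> a <# A" using lcos_self[OF _ A] a sc by auto
    have "a <# A \<noteq> (a \<otimes> s) <# A"
    proof
      assume "a <# A = (a \<otimes> s) <# A"
      then obtain h where "h \<in> A" "a \<otimes> s = a \<otimes> h" using in_coset by (auto simp: l_coset_def)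
      then show False using False a sc by simp
    qed
    moreover have "a <# A \<in> lcosets A" "(a \<otimes> s) <# A \<in> lcosets A"
      using a sc by (auto simp: LCOSETS_def)
    ultimately have "((a \<otimes> s) <# A, a <# A) \<in> snd (schreier_graph G A (S - A))"
      using in_coset s False by (auto simp: schreier_graph_def)
    then show ?thesis using p by (auto simp: proper_coloring_def)
  qed
qed

section \<open>Partial characters\<close>

text \<open>
  These are the homomorphisms to the circle \<open>\<real>/\<int>\<close> defined on a subgroup of \<open>G\<close>. The map
  is encoded by the preimage of its graph under \<open>G \<times> \<real> \<rightarrow> G \<times> \<real>/\<int>\<close>, a subgroup of
  \<open>G \<times> \<real>\<close> whose fibre over \<open>\<one>\<close> is exactly \<open>\<int>\<close>. In this form extension is inclusion,
  and the union of a chain is again such a map.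
\<close>
definition partial_character :: "('a, 'b) monoid_scheme \<Rightarrow> ('a \<times> real) set \<Rightarrow> bool" where
  "partial_character G F \<longleftrightarrow>
     Domain F \<subseteq> carrier G \<and>
     {s. (\<one>\<^bsub>G\<^esub>, s) \<in> F} = \<int> \<and>
     (\<forall>x s y t. (x, s) \<in> F \<longrightarrow> (y, t) \<in> F \<longrightarrow> (x \<otimes>\<^bsub>G\<^esub> inv\<^bsub>G\<^esub> y, s - t) \<in> F)"

context group
begin

lemma partial_character_carrier: "partial_character G F \<Longrightarrow> (x, s) \<in> F \<Longrightarrow> x \<in> carrier G"
  by (auto simp: partial_character_def)

lemma partial_character_one_iff: "partial_character G F \<Longrightarrow> (\<one>, s) \<in> F \<longleftrightarrow> s \<in> \<int>"
  by (auto simp: partial_character_def)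

lemma partial_character_divide:
  "partial_character G F \<Longrightarrow> (x, s) \<in> F \<Longrightarrow> (y, t) \<in> F \<Longrightarrow> (x \<otimes> inv y, s - t) \<in> F"
  by (auto simp: partial_character_def)

lemma partial_character_inv:
  assumes "partial_character G F" "(x, s) \<in> F" shows "(inv x, - s) \<in> F"
  using partial_character_divide[OF assms(1) _ assms(2), of \<one> 0] assms
  by (auto simp: partial_character_one_iff dest: partial_character_carrier)

lemma partial_character_mult:
  assumes F: "partial_character G F" and "(x, s) \<in> F" "(y, t) \<in> F"
  shows "(x \<otimes> y, s + t) \<in> F"
  using partial_character_divide[OF F assms(2) partial_character_inv[OF F assms(3)]]
    partial_character_carrier[OF F assms(3)] by simp

lemma partial_character_nat_pow:
  assumes F: "partial_character G F" and "(x, s) \<in> F"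
  shows "(x [^] (n::nat), real n * s) \<in> F"
proof (induction n)
  case 0
  then show ?case using F by (simp add: partial_character_one_iff)
next
  case (Suc n)
  then show ?case using partial_character_mult[OF F Suc.IH assms(2)]
    by (simp add: algebra_simps)
qed

lemma partial_character_int_pow:
  assumes F: "partial_character G F" and x: "(x, s) \<in> F"
  shows "(x [^] (n::int), of_int n * s) \<in> F"
proof (cases n rule: int_cases2)
  case (nonneg m)
  then show ?thesis using partial_character_nat_pow[OF F x] by (simp add: int_pow_int)
next
  case (nonpos m)
  then show ?thesis
    using partial_character_inv[OF F partial_character_nat_pow[OF F x, of m]]
      partial_character_carrier[OF F x]
    by (simp add: int_pow_neg int_pow_int)
qed

lemma partial_character_unique:
  assumes F: "partial_character G F" and "(x, s) \<in> F" "(x, t) \<in> F"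
  shows "s - t \<in> \<int>"
  using partial_character_divide[OF assms] partial_character_carrier[OF F assms(2)] F
  by (simp add: partial_character_one_iff)

lemma subgroup_Domain_partial_character:
  assumes F: "partial_character G F"
  shows "subgroup (Domain F) G"
proof (rule subgroupI)
  show "Domain F \<subseteq> carrier G" using F by (simp add: partial_character_def)
  show "Domain F \<noteq> {}" using partial_character_one_iff[OF F, of 0] by auto
qed (auto dest: partial_character_mult[OF F] partial_character_inv[OF F])

text \<open>
  The condition on \<open>t\<close> is exactly what is needed for \<open>c \<mapsto> t\<close> to be compatible with the
  values of \<open>F\<close> on those powers of \<open>c\<close> that already lie in its domain. Only multiples of the least
  positive exponent \<open>m\<close> give such powers, so it is enough that \<open>m * t\<close> be correct modulo \<open>\<int>\<close>;
  \<open>c \<notin> Domain F\<close> excludes \<open>m = 1\<close>, the one case in which the solutions may all miss \<open>[1/4, 3/4]\<close>.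
\<close>
lemma partial_character_extension_value:
  assumes F: "partial_character G F" and c: "c \<in> carrier G" "c \<notin> Domain F"
  obtains t where "1/4 \<le> t" "t \<le> 3/4"
    "\<And>(n::int) u. (c [^] n, u) \<in> F \<Longrightarrow> of_int n * t - u \<in> \<int>"
proof -
  interpret D: subgroup "Domain F" G by (rule subgroup_Domain_partial_character[OF F])
  show thesis
  proof (cases "\<exists>m::nat. m > 0 \<and> c [^] m \<in> Domain F")
    case False
    have "of_int n * (1/2) - u \<in> \<int>" if n: "(c [^] n, u) \<in> F" for n :: int and u
    proof -
      have "n = 0"
      proof (rule ccontr)
        assume "n \<noteq> 0"
        obtain m :: nat where "m > 0" "n = int m \<or> n = - int m"
          using \<open>n \<noteq> 0\<close> by (cases n rule: int_cases2) auto
        then have "c [^] n = c [^] m \<or> c [^] n = inv (c [^] m)"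
          using c by (auto simp: int_pow_neg int_pow_int)
        moreover have "c [^] n \<in> Domain F" using n by blast
        ultimately have "c [^] m \<in> Domain F"
          using D.m_inv_closed c by (metis inv_inv nat_pow_closed)
        then show False using False \<open>m > 0\<close> by blast
      qed
      then have "(\<one>, u) \<in> F" using n by simp
      then show ?thesis using \<open>n = 0\<close> F by (simp add: partial_character_one_iff)
    qed
    then show thesis by (intro that[of "1/2"]) auto
  next
    case True
    define m where "m = (LEAST m::nat. m > 0 \<and> c [^] m \<in> Domain F)"
    have m: "m > 0" "c [^] m \<in> Domain F"
      using LeastI_ex[OF True] unfolding m_def by auto
    have least: "\<not> (0 < j \<and> j < m \<and> c [^] j \<in> Domain F)" for j :: nat
      unfolding m_def using not_less_Least by blast
    have "m \<noteq> 1" using m c by auto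
    then have m2: "m \<ge> 2" using m by simp
    obtain u where u: "(c [^] m, u) \<in> F" using m by auto
    \<comment> \<open>The solutions are \<open>(u + j) / m\<close>; \<open>j\<close> picks the least one that is at least \<open>1/4\<close>.\<close>
    define j where "j = \<lceil>real m / 4 - u\<rceil>"
    define t where "t = (u + of_int j) / real m"
    have j: "real m / 4 - u \<le> of_int j" "of_int j < real m / 4 - u + 1"
      unfolding j_def by linarith+
    have t1: "1/4 \<le> t" using j m unfolding t_def by (simp add: field_simps)
    have t2: "t \<le> 3/4" using j m m2 unfolding t_def by (simp add: field_simps)
    have mt: "real m * t = u + of_int j" using m unfolding t_def by simp
    have "of_int n * t - v \<in> \<int>" if n: "(c [^] n, v) \<in> F" for n :: int and v
    proof -
      define q where "q = n div int m"
      define e where "e = nat (n mod int m)"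
      have ne: "n = int m * q + int e" using m by (simp add: q_def e_def)
      have qu: "((c [^] m) [^] q, of_int q * u) \<in> F" by (rule partial_character_int_pow[OF F u])
      have cq: "(c [^] m) [^] q = c [^] (int m * q)"
        using int_pow_pow[OF c(1), of "int m" q] by (simp add: int_pow_int)
      have "c [^] n \<otimes> inv ((c [^] m) [^] q) = c [^] int e"
        using int_pow_diff[OF c(1), of n "int m * q"] unfolding cq by (simp add: ne)
      then have "c [^] e \<in> Domain F"
        using partial_character_divide[OF F n qu] by (auto simp: int_pow_int)
      moreover have "e < m" using m by (simp add: e_def nat_less_iff)
      ultimately have "e = 0" using least[of e] by auto
      then have n': "n = int m * q" using ne by simp
      have "of_int q * u - v \<in> \<int>"
        using partial_character_unique[OF F qu] n unfolding cq n' by simp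
      moreover have "of_int n * t = of_int q * (real m * t)" by (simp add: n')
      then have "of_int n * t = of_int q * u + of_int (q * j)"
        unfolding mt by (simp add: distrib_left)
      ultimately show ?thesis
        using Ints_add[of "of_int q * u - v" "of_int (q * j)"] by (simp add: algebra_simps)
    qed
    with t1 t2 show thesis by (rule that)
  qed
qed

end

text \<open>
  The value found above extends \<open>F\<close> to the subgroup generated by its domain and \<open>c\<close>; the
  compatibility condition says precisely that the fibre over \<open>\<one>\<close> does not grow.
\<close>
lemma (in comm_group) partial_character_extend:
  assumes F: "partial_character G F" and c: "c \<in> carrier G" "c \<notin> Domain F"
  obtains F' t where "partial_character G F'" "F \<subseteq> F'" "(c, t) \<in> F'" "1/4 \<le> t" "t \<le> 3/4"
    "Domain F' \<subseteq> {x \<otimes> c [^] n | x (n::int). x \<in> Domain F}"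
proof -
  obtain t where t: "1/4 \<le> t" "t \<le> 3/4"
    "\<And>(n::int) u. (c [^] n, u) \<in> F \<Longrightarrow> of_int n * t - u \<in> \<int>"
    using partial_character_extension_value[OF F c] by blast
  define F' where "F' = {(x \<otimes> c [^] n, s + of_int n * t) | x s (n::int). (x, s) \<in> F}"
  have F'I: "(x \<otimes> c [^] n, s + of_int n * t) \<in> F'" if "(x, s) \<in> F" for x s and n :: int
    using that by (auto simp: F'_def)
  have one: "(\<one>, 0) \<in> F" using F by (simp add: partial_character_one_iff)
  have FF': "F \<subseteq> F'"
  proof
    fix p assume p: "p \<in> F"
    obtain x s where xs: "p = (x, s)" by fastforce
    have "x \<in> carrier G" using partial_character_carrier[OF F] p xs by simp
    then show "p \<in> F'" using F'I[of x s 0] p xs by simp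
  qed
  have ct: "(c, t) \<in> F'" using F'I[OF one, of 1] c by simp
  have "partial_character G F'"
    unfolding partial_character_def
  proof (intro conjI allI impI)
    show "Domain F' \<subseteq> carrier G"
      using c by (auto simp: F'_def dest: partial_character_carrier[OF F])
    show "{s. (\<one>, s) \<in> F'} = \<int>"
    proof
      show "\<int> \<subseteq> {s. (\<one>, s) \<in> F'}" using FF' F by (auto simp: partial_character_one_iff)
      show "{s. (\<one>, s) \<in> F'} \<subseteq> \<int>"
      proof
        fix v assume "v \<in> {s. (\<one>, s) \<in> F'}"
        then obtain x s n where x: "(x, s) \<in> F" "\<one> = x \<otimes> c [^] (n::int)" "v = s + of_int n * t"
          by (auto simp: F'_def)
        have xc: "x \<in> carrier G" using partial_character_carrier[OF F x(1)] .
        have "c [^] n = inv x"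
          using inv_equality[of "c [^] n" x] x xc c m_comm by (metis int_pow_closed inv_equality)
        then have "(c [^] n, - s) \<in> F" using partial_character_inv[OF F x(1)] by simp
        from t(3)[OF this] show "v \<in> \<int>" using x by (simp add: algebra_simps)
      qed
    qed
    fix x s y u assume "(x, s) \<in> F'" "(y, u) \<in> F'"
    then obtain x' s' n y' u' l where
      x: "(x', s') \<in> F" "x = x' \<otimes> c [^] (n::int)" "s = s' + of_int n * t" and
      y: "(y', u') \<in> F" "y = y' \<otimes> c [^] (l::int)" "u = u' + of_int l * t"
      by (auto simp: F'_def)
    have xy: "x' \<in> carrier G" "y' \<in> carrier G"
      using partial_character_carrier[OF F] x y by blast+
    have "x \<otimes> inv y = (x' \<otimes> inv y') \<otimes> c [^] (n - l)"
      using xy c by (simp add: x y inv_mult_group int_pow_diff m_ac)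
    moreover have "s - u = (s' - u') + of_int (n - l) * t" by (simp add: x y algebra_simps)
    moreover have "(x' \<otimes> inv y', s' - u') \<in> F" by (rule partial_character_divide[OF F x(1) y(1)])
    ultimately show "(x \<otimes> inv y, s - u) \<in> F'" using F'I by metis
  qed
  moreover have "Domain F' \<subseteq> {x \<otimes> c [^] n | x (n::int). x \<in> Domain F}"
    by (auto simp: F'_def)
  ultimately show thesis using FF' ct t(1,2) that by blast
qed

lemma (in group) partial_character_Union:
  assumes chain: "chain\<^sub>\<subseteq> \<C>" and "\<C> \<noteq> {}" and pc: "\<And>F. F \<in> \<C> \<Longrightarrow> partial_character G F"
  shows "partial_character G (\<Union>\<C>)"
  unfolding partial_character_def
proof (intro conjI allI impI)
  show "Domain (\<Union>\<C>) \<subseteq> carrier G" using pc by (auto dest: partial_character_carrier)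
  show "{s. (\<one>, s) \<in> \<Union>\<C>} = \<int>" using assms by (auto simp: partial_character_one_iff)
  fix x s y t assume "(x, s) \<in> \<Union>\<C>" "(y, t) \<in> \<Union>\<C>"
  then obtain F where "F \<in> \<C>" "(x, s) \<in> F" "(y, t) \<in> F"
    using chain by (fastforce simp: chain_subset_def)
  then show "(x \<otimes> inv y, s - t) \<in> \<Union>\<C>" using partial_character_divide[OF pc] by blast
qed

section \<open>Abelian groups\<close>

text \<open>
  All indices outside the initial segment \<open>I\<close> lie above \<open>I\<close>, so semiminimality keeps their members
  out of the subgroup generated by \<open>I\<close>. This prevents the construction of a character from fixing a
  value at a later member unintentionally.
\<close>
lemma semiminimal_family_avoids_initial_segment:
  assumes "group G" and c: "semiminimal_family G r c"
    and I: "I \<subseteq> Field r" "\<And>i j. j \<in> I \<Longrightarrow> (i, j) \<in> r \<Longrightarrow> i \<in> I"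
    and j: "j \<in> Field r" "c j \<in> generate G (c ` I)"
  shows "j \<in> I"
proof (rule ccontr)
  interpret group G by fact
  assume "j \<notin> I"
  have wo: "wo_rel r" using c by (simp add: semiminimal_family_def wo_rel_def)
  have "I \<subseteq> underS r j"
  proof
    fix i assume "i \<in> I"
    then have "i \<noteq> j" "(j, i) \<notin> r" using \<open>j \<notin> I\<close> I by blast+
    then show "i \<in> underS r j"
      using wo_rel.TOTALS[OF wo] \<open>i \<in> I\<close> I j by (auto simp: underS_def)
  qed
  then have "c j \<in> generate G (c ` underS r j)"
    using j mono_generate[of "c ` I" "c ` underS r j"] by blast
  then show False using c j by (simp add: semiminimal_family_def)
qed

text \<open>
  Zorn's lemma is applied to the characters whose domain is contained in the subgroup generated by an
  initial segment of the family and that have a value in \<open>[1/4, 3/4]\<close> at each member of it. If the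
  segment is not everything, the first missing member is outside the domain, and the character extends
  to it.
\<close>
lemma (in comm_group) semiminimal_partial_character:
  assumes c: "semiminimal_family G r c"
  obtains F where "partial_character G F"
    "\<And>i. i \<in> Field r \<Longrightarrow> \<exists>t. (c i, t) \<in> F \<and> 1/4 \<le> t \<and> t \<le> 3/4"
proof -
  interpret wo_rel r using c by (simp add: semiminimal_family_def wo_rel_def)
  have cc: "c i \<in> carrier G" if "i \<in> Field r" for i
    using c that by (simp add: semiminimal_family_def)
  \<comment> \<open>Reading the segment off the domain of \<open>F\<close> makes it commute with unions of chains.\<close>
  define J where "J F = {i \<in> Field r. c i \<in> Domain F}" for F :: "('a \<times> real) set"
  define P where "P = {F. partial_character G F \<and> Domain F \<subseteq> generate G (c ` J F) \<and>
     (\<forall>i j. j \<in> J F \<longrightarrow> (i, j) \<in> r \<longrightarrow> i \<in> J F) \<and>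
     (\<forall>i \<in> J F. \<exists>t. (c i, t) \<in> F \<and> 1/4 \<le> t \<and> t \<le> 3/4)}"
  have J_mono: "J F \<subseteq> J F'" if "F \<subseteq> F'" for F F'
    using that by (auto simp: J_def)
  have "\<exists>M \<in> P. \<forall>F \<in> P. M \<subseteq> F \<longrightarrow> F = M"
  proof (rule Zorn_Lemma2, rule ballI)
    fix \<C> assume "\<C> \<in> chains P"
    then have chain: "chain\<^sub>\<subseteq> \<C>" and sub: "\<C> \<subseteq> P" by (auto simp: chains_def)
    show "\<exists>u \<in> P. \<forall>F \<in> \<C>. F \<subseteq> u"
    proof (cases "\<C> = {}")
      case True
      define T where "T = {\<one>} \<times> (\<int> :: real set)"
      have "c i \<noteq> \<one>" if "i \<in> Field r" for i
        using c that generate.one[of G] by (metis semiminimal_family_def)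
      then have "J T = {}" by (auto simp: J_def T_def)
      moreover have "partial_character G T" by (auto simp: partial_character_def T_def)
      ultimately have "T \<in> P" by (auto simp: P_def T_def intro: generate.one)
      then show ?thesis using True by blast
    next
      case False
      have "partial_character G (\<Union>\<C>)"
        using partial_character_Union[OF chain False] sub by (auto simp: P_def)
      moreover have "J (\<Union>\<C>) = (\<Union>F \<in> \<C>. J F)" by (auto simp: J_def)
      moreover have "Domain F \<subseteq> generate G (c ` J (\<Union>\<C>))" if "F \<in> \<C>" for F
      proof -
        have "c ` J F \<subseteq> c ` J (\<Union>\<C>)" using J_mono[of F "\<Union>\<C>"] that by blast
        from mono_generate[OF this] show ?thesis using that sub unfolding P_def by blast
      qed
      then have "Domain (\<Union>\<C>) \<subseteq> generate G (c ` J (\<Union>\<C>))" by blast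
      moreover have "\<forall>i j. j \<in> (\<Union>F \<in> \<C>. J F) \<longrightarrow> (i, j) \<in> r \<longrightarrow> i \<in> (\<Union>F \<in> \<C>. J F)"
        using sub unfolding P_def by blast
      moreover have "\<forall>i \<in> (\<Union>F \<in> \<C>. J F). \<exists>t. (c i, t) \<in> \<Union>\<C> \<and> 1/4 \<le> t \<and> t \<le> 3/4"
        using sub unfolding P_def by blast
      ultimately have "\<Union>\<C> \<in> P" unfolding P_def by simp
      then show ?thesis by blast
    qed
  qed
  then obtain F where FP: "F \<in> P" and max: "\<And>F'. F' \<in> P \<Longrightarrow> F \<subseteq> F' \<Longrightarrow> F' = F" by blast
  have F: "partial_character G F" and gen: "Domain F \<subseteq> generate G (c ` J F)"
    and down: "\<And>i j. j \<in> J F \<Longrightarrow> (i, j) \<in> r \<Longrightarrow> i \<in> J F"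
    and far: "\<And>i. i \<in> J F \<Longrightarrow> \<exists>t. (c i, t) \<in> F \<and> 1/4 \<le> t \<and> t \<le> 3/4"
    using FP by (auto simp: P_def)
  have "J F = Field r"
  proof (rule ccontr)
    assume "J F \<noteq> Field r"
    then have ne: "Field r - J F \<noteq> {}" "Field r - J F \<subseteq> Field r" by (auto simp: J_def)
    define a where "a = minim (Field r - J F)"
    have a: "a \<in> Field r" "a \<notin> J F" using minim_in[OF ne(2,1)] by (auto simp: a_def)
    have a_least: "i \<in> J F" if "(i, a) \<in> r" "i \<noteq> a" for i
      using minim_least[OF ne(2), of i] that ANTISYM FieldI1[OF that(1)]
      unfolding a_def antisym_def by blast
    define I where "I = insert a (J F)"
    have I: "I \<subseteq> Field r" using a by (auto simp: I_def J_def)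
    have Idown: "i \<in> I" if "j \<in> I" "(i, j) \<in> r" for i j
      using that a_least down by (auto simp: I_def)
    have "c a \<notin> Domain F" using a by (simp add: J_def)
    from partial_character_extend[OF F cc[OF a(1)] this]
    obtain F' t where F': "partial_character G F'" "F \<subseteq> F'" "(c a, t) \<in> F'"
        "1/4 \<le> t" "t \<le> 3/4" "Domain F' \<subseteq> {x \<otimes> c a [^] n | x (n::int). x \<in> Domain F}"
      .
    have cI: "c ` I \<subseteq> carrier G" using I cc by blast
    interpret H: subgroup "generate G (c ` I)" G by (rule generate_is_subgroup[OF cI])
    have "c a \<in> generate G (c ` I)" by (simp add: I_def generate.incl)
    then have "c a [^] n \<in> generate G (c ` I)" for n :: int
      by (rule subgroup_int_pow_closed[OF generate_is_subgroup[OF cI]])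
    moreover have "Domain F \<subseteq> generate G (c ` I)"
      using gen mono_generate[of "c ` J F" "c ` I"] by (auto simp: I_def)
    ultimately have gen': "Domain F' \<subseteq> generate G (c ` I)"
      using F'(6) by (blast intro: H.m_closed)
    have JF': "J F' = I"
    proof
      show "I \<subseteq> J F'" using J_mono[OF F'(2)] F'(3) a by (auto simp: I_def J_def)
      show "J F' \<subseteq> I"
        using semiminimal_family_avoids_initial_segment[OF is_group c I Idown] gen'
        by (auto simp: J_def)
    qed
    have "\<exists>t. (c i, t) \<in> F' \<and> 1/4 \<le> t \<and> t \<le> 3/4" if "i \<in> I" for i
      using that far F'(2-5) unfolding I_def by blast
    then have "F' \<in> P"
      unfolding P_def mem_Collect_eq JF' using F'(1) gen' Idown by blast
    then have "F' = F" using max F'(2) by blast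
    then show False using JF' a by (auto simp: I_def)
  qed
  then show thesis using that[OF F] far by blast
qed

text \<open>
  Two points of \<open>[0, 1)\<close> in the same quarter differ by less than \<open>1/4\<close>, whereas no number congruent
  modulo \<open>\<int>\<close> to a point of \<open>[1/4, 3/4]\<close> has absolute value below \<open>1/4\<close>.
\<close>
lemma distinct_quarters:
  fixes s s' t :: real
  assumes "s' - s - t \<in> \<int>" "1/4 \<le> t" "t \<le> 3/4"
  shows "\<lfloor>4 * frac s\<rfloor> \<noteq> \<lfloor>4 * frac s'\<rfloor>"
proof
  assume eq: "\<lfloor>4 * frac s\<rfloor> = \<lfloor>4 * frac s'\<rfloor>"
  then have close: "\<bar>frac s' - frac s\<bar> < 1/4" by linarith
  obtain n :: int where "s' - s - t = of_int n" using assms(1) by (elim Ints_cases)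
  then have "frac s' - frac s = t + of_int (n - \<lfloor>s'\<rfloor> + \<lfloor>s\<rfloor>)"
    by (simp add: frac_def)
  then obtain z :: int where z: "frac s' - frac s = t + of_int z" by blast
  have "z \<ge> 0 \<or> z \<le> -1" by linarith
  then show False
  proof
    assume "z \<ge> 0"
    then have "of_int z \<ge> (0::real)" by simp
    then show False using z close assms by linarith
  next
    assume "z \<le> -1"
    then have "of_int z \<le> (-1::real)" by linarith
    then show False using z close assms by linarith
  qed
qed

text \<open>
  The character is defined only on a subgroup \<open>H\<close> containing the family; the coloring by quarters is
  carried from \<open>H\<close> to the whole group along cosets.
\<close>
theorem (in comm_group) semiminimal_cayley_four_coloring:
  assumes c: "semiminimal_family G r c"
  obtains f :: "'a \<Rightarrow> nat"
    where "proper_coloring (cayley_graph G (c ` Field r)) f" "f ` carrier G \<subseteq> {..<4}"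
proof -
  obtain F where F: "partial_character G F"
    and far: "\<And>i. i \<in> Field r \<Longrightarrow> \<exists>t. (c i, t) \<in> F \<and> 1/4 \<le> t \<and> t \<le> 3/4"
    using semiminimal_partial_character[OF c] by metis
  define H where "H = Domain F"
  have H: "subgroup H G" unfolding H_def by (rule subgroup_Domain_partial_character[OF F])
  interpret GH: group "G\<lparr>carrier := H\<rparr>" by (rule subgroup_imp_group[OF H])
  have S: "c ` Field r \<subseteq> H" using far by (force simp: H_def)
  define v where "v x = (SOME s. (x, s) \<in> F)" for x
  have v: "(x, v x) \<in> F" if "x \<in> H" for x
    using that unfolding v_def H_def by (auto intro: someI)
  define f where "f x = nat \<lfloor>4 * frac (v x)\<rfloor>" for x
  have "f x < 4" for x
    using frac_lt_1[of "v x"] frac_ge_0[of "v x"] unfolding f_def by linarith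
  then have f4: "f ` H \<subseteq> {..<4}" by auto
  have "proper_coloring (cayley_graph (G\<lparr>carrier := H\<rparr>) (c ` Field r)) f"
  proof (subst GH.proper_coloring_cayley_iff, use S in simp, intro ballI impI, simp)
    fix a s assume a: "a \<in> H" and s: "s \<in> c ` Field r"
    obtain t where t: "(s, t) \<in> F" "1/4 \<le> t" "t \<le> 3/4" using far s by blast
    have "a \<otimes> s \<in> H" using a s S subgroup.m_closed[OF H] by blast
    then have "v (a \<otimes> s) - (v a + t) \<in> \<int>"
      using partial_character_unique[OF F v partial_character_mult[OF F v[OF a] t(1)]] by blast
    then have "\<lfloor>4 * frac (v a)\<rfloor> \<noteq> \<lfloor>4 * frac (v (a \<otimes> s))\<rfloor>"
      using t by (intro distinct_quarters[of _ _ t]) (simp_all add: algebra_simps)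
    then show "f a \<noteq> f (a \<otimes> s)"
      using frac_ge_0 by (simp add: f_def nat_eq_iff)
  qed
  from cayley_coloring_from_subgroup[OF H S this] show thesis
    using f4 that by (metis subset_trans)
qed

section \<open>Groups with an abelian subgroup\<close>

lemma (in group) semiminimal_family_subgroup:
  assumes A: "subgroup A G" and c: "semiminimal_family G r c"
  defines "r' \<equiv> Restr r {i. c i \<in> A}"
  shows "semiminimal_family (G\<lparr>carrier := A\<rparr>) r' c" and "c ` Field r' = c ` Field r \<inter> A"
proof -
  have wo: "Well_order r" using c by (simp add: semiminimal_family_def)
  then have wo': "Well_order r'" unfolding r'_def by (rule Well_order_Restr)
  have "Refl r" using wo by (simp add: order_on_defs)
  then have Fr: "Field r' = {i \<in> Field r. c i \<in> A}"
    unfolding r'_def by (subst Refl_Field_Restr) auto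
  then show "c ` Field r' = c ` Field r \<inter> A" by auto
  have "c i \<notin> generate (G\<lparr>carrier := A\<rparr>) (c ` underS r' i)" if i: "i \<in> Field r'" for i
  proof
    have u: "underS r' i \<subseteq> Field r'" by (auto simp: underS_def Field_def)
    assume "c i \<in> generate (G\<lparr>carrier := A\<rparr>) (c ` underS r' i)"
    moreover have "c ` underS r' i \<subseteq> A" using u Fr by auto
    ultimately have "c i \<in> generate G (c ` underS r' i)"
      using generate_consistent[OF _ A] by simp
    moreover have "c ` underS r' i \<subseteq> c ` underS r i" by (auto simp: r'_def underS_def)
    ultimately have "c i \<in> generate G (c ` underS r i)" using mono_generate by blast
    then show False using c i Fr by (simp add: semiminimal_family_def)
  qed
  then show "semiminimal_family (G\<lparr>carrier := A\<rparr>) r' c"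
    using wo' c Fr by (auto simp: semiminimal_family_def)
qed

theorem corollary5p3:
  fixes G :: "('a, 'b) monoid_scheme" and A :: "'a set" and k :: "'k rel"
    and r :: "'i rel" and c :: "'i \<Rightarrow> 'a"
  assumes "group G"
    and "subgroup A G" and "comm_group (G\<lparr>carrier := A\<rparr>)"
    and "Card_order k" and "|lcosets\<^bsub>G\<^esub> A| =o k"
    and "semiminimal_family G r c"
  shows "chromatic_number (cayley_graph G (c ` Field r))
           \<le>o |{..<4::nat}| *c chromatic_number (schreier_graph G A (c ` Field r - A))
       \<and> |{..<4::nat}| *c chromatic_number (schreier_graph G A (c ` Field r - A))
           \<le>o |{..<4::nat}| *c k"
proof
  interpret group G by fact
  interpret CA: comm_group "G\<lparr>carrier := A\<rparr>" by fact
  let ?S = "c ` Field r"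
  let ?Sch = "schreier_graph G A (?S - A)"
  let ?Cay = "cayley_graph G ?S"
  have S: "?S \<subseteq> carrier G" using assms(6) by (auto simp: semiminimal_family_def)
  have vertices: "fst ?Sch = lcosets\<^bsub>G\<^esub> A" "fst ?Cay = carrier G"
    by (simp_all add: schreier_graph_def cayley_graph_def)
  obtain f0 :: "'a \<Rightarrow> nat"
    where f0: "proper_coloring (cayley_graph (G\<lparr>carrier := A\<rparr>) (?S \<inter> A)) f0" "f0 ` A \<subseteq> {..<4}"
    using CA.semiminimal_cayley_four_coloring[OF semiminimal_family_subgroup(1)[OF assms(2,6)]]
    unfolding semiminimal_family_subgroup(2)[OF assms(2,6)] by auto
  obtain f where f: "proper_coloring (cayley_graph G (?S \<inter> A)) f" "f ` carrier G \<subseteq> f0 ` A"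
    using cayley_coloring_from_subgroup[OF assms(2) _ f0(1)] by auto
  obtain p where p: "proper_coloring ?Sch p" "chromatic_number ?Sch = |p ` fst ?Sch|"
    using chromatic_number_attained[OF irrefl_schreier_graph] by blast
  let ?h = "\<lambda>x. (f x, p (x <#\<^bsub>G\<^esub> A))"
  have "chromatic_number ?Cay \<le>o |?h ` fst ?Cay|"
  proof (rule chromatic_number_le[OF irrefl_cayley_graph])
    show "snd ?Cay \<subseteq> fst ?Cay \<times> fst ?Cay" by (auto simp: cayley_graph_def)
    show "proper_coloring ?Cay ?h"
      by (rule proper_coloring_cayley_schreier[OF assms(2) S f(1) p(1)])
  qed
  also have "?h ` fst ?Cay \<subseteq> {..<4} \<times> (p ` fst ?Sch)"
    using f(2) f0(2) unfolding vertices by (auto simp: LCOSETS_def)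
  then have "|?h ` fst ?Cay| \<le>o |{..<4::nat} \<times> (p ` fst ?Sch)|" by (rule card_of_mono1)
  also have "|{..<4::nat} \<times> (p ` fst ?Sch)| = |{..<4::nat}| *c chromatic_number ?Sch"
    by (simp add: cprod_def p(2) Field_card_of)
  finally show "chromatic_number ?Cay \<le>o |{..<4::nat}| *c chromatic_number ?Sch" .
  have "chromatic_number ?Sch \<le>o |id ` fst ?Sch|"
    by (rule chromatic_number_le[OF irrefl_schreier_graph])
      (auto simp: schreier_graph_def proper_coloring_def)
  then have "chromatic_number ?Sch \<le>o k"
    using assms(5) ordLeq_ordIso_trans unfolding vertices by auto
  then show "|{..<4::nat}| *c chromatic_number ?Sch \<le>o |{..<4::nat}| *c k"
    by (rule cprod_mono2)
qed

end
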